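(* Let $H$ be a real Hilbert space, let $K$ be a cone in $H$, and let $T\in \mathcal{B}(H)$ be a self-adjoint operator such that $m_r(T) >0$. Let $b \in R(T)$ and $x_b=-\frac{1}{2} T^\dagger b$. Then for every solution $x\in R(T)$ of $LCP(T,b)$ with $x\neq x_b$, one has $$\frac{\| b \|}{2M(T)}\leq \| x-x_b \| \leq \frac{\| b \|}{2m_r(T)}.$$
   Context: $\mathcal{B}(H)$ is the set of bounded linear operators on $H$; $T^*$ is the adjoint of $T$ and $R(\cdot)$ denotes range. A subset $K\subseteq H$ is a cone if $x,y\in K$ and $\lambda\ge 0$ imply $x+y\in K$ and $\lambda x\in K$, and $K\cap(-K)=\{0\}$. Its dual cone is $K^*=\{y\in H: \langle y,x\rangle\ge 0 \text{ for all } x\in K\}$ (continuous linear functionals on $H$ being identified with vectors of $H$). The linear complementarity problem $LCP(T,b)$ (with respect to $K$) is to find $z\in K$ such that $Tz+b\in K^*$ and $\langle z,Tz+b\rangle=0$. Define $M(T)=\sup\{\langle Tx,x\rangle : x\in H,\ \|x\|=1\}$ and $m_r(T)=\inf\{\langle Tx,x\rangle : x\in R(T^* ),\ \|x\|=1\}$. The Moore-Penrose inverse $T^\dagger$ is the unique $S\in\mathcal{B}(H)$ with $TST=T$, $STS=S$, $(TS)^*=TS$, $(ST)^*=ST$; it exists if and only if $R(T)$ is closed, which is the case for self-adjoint $T$ with $m_r(T)>0$. *)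

theory Defs
  imports "HOL-Analysis.Analysis"
begin

text \<open>
  A real Hilbert space is a type of sort \<open>{real_inner, complete_space}\<close>. Elements of \<open>B(H)\<close> are
  functions \<open>T\<close> with \<open>bounded_linear T\<close>, and \<open>T\<^sup>*\<close> is the library's \<open>adjoint T\<close>.
\<close>

text \<open>The library's \<open>cone\<close> and \<open>convex_cone\<close> do not require pointedness \<open>K \<inter> (- K) = {0}\<close>.\<close>

definition pointed_convex_cone :: "'a::real_vector set \<Rightarrow> bool" where
  "pointed_convex_cone K \<longleftrightarrow>
     (\<forall>x\<in>K. \<forall>y\<in>K. \<forall>c\<ge>0. x + y \<in> K \<and> c *\<^sub>R x \<in> K) \<and> K \<inter> uminus ` K = {0}"

definition dual_cone :: "'a::real_inner set \<Rightarrow> 'a set" where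
  "dual_cone K = {y. \<forall>x\<in>K. y \<bullet> x \<ge> 0}"

definition lcp_solution :: "'a::real_inner set \<Rightarrow> ('a \<Rightarrow> 'a) \<Rightarrow> 'a \<Rightarrow> 'a \<Rightarrow> bool" where
  "lcp_solution K T b z \<longleftrightarrow> z \<in> K \<and> T z + b \<in> dual_cone K \<and> z \<bullet> (T z + b) = 0"

text \<open>
  The values are extended reals so that the supremum and infimum over an empty set of unit vectors
  are \<open>-\<infinity>\<close> and \<open>\<infinity>\<close> (on \<open>real\<close> they would be unspecified). The infimum is over an empty set
  exactly when \<open>T\<^sup>* = 0\<close>.
\<close>

definition num_sup :: "('a::real_inner \<Rightarrow> 'a) \<Rightarrow> ereal" where
  "num_sup T = (SUP x\<in>{x. norm x = 1}. ereal (T x \<bullet> x))"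

definition reduced_num_inf :: "('a::real_inner \<Rightarrow> 'a) \<Rightarrow> ereal" where
  "reduced_num_inf T = (INF x\<in>{x \<in> range (adjoint T). norm x = 1}. ereal (T x \<bullet> x))"

definition is_mp_inverse :: "('a::real_inner \<Rightarrow> 'a) \<Rightarrow> ('a \<Rightarrow> 'a) \<Rightarrow> bool" where
  "is_mp_inverse T S \<longleftrightarrow> bounded_linear S \<and>
     T \<circ> S \<circ> T = T \<and> S \<circ> T \<circ> S = S \<and>
     adjoint (T \<circ> S) = T \<circ> S \<and> adjoint (S \<circ> T) = S \<circ> T"

text \<open>Meaningful only if \<open>T\<close> has closed range; otherwise no such \<open>S\<close> exists.\<close>

definition mp_inverse :: "('a::real_inner \<Rightarrow> 'a) \<Rightarrow> 'a \<Rightarrow> 'a" where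
  "mp_inverse T = (THE S. is_mp_inverse T S)"

end

theory Submission
  imports Defs
begin

text \<open>
  A solution \<open>x\<close> satisfies \<open>Tx \<bullet> x + b \<bullet> x = 0\<close>. Completing the square with \<open>p = T\<^sup>\<dagger> b\<close> turns this
  into \<open>T (x - x\<^sub>b) \<bullet> (x - x\<^sub>b) = (b \<bullet> p) / 4\<close>. On \<open>R(T)\<close> the form \<open>Tv \<bullet> v\<close> lies between
  \<open>m\<^sub>r(T) \<parallel>v\<parallel>\<^sup>2\<close> and \<open>M(T) \<parallel>v\<parallel>\<^sup>2\<close>, and \<open>\<parallel>b\<parallel>\<^sup>2 / M(T) \<le> b \<bullet> p \<le> \<parallel>b\<parallel>\<^sup>2 / m\<^sub>r(T)\<close>: the
  upper bound is coercivity at \<open>p\<close>, the lower one is the Cauchy-Schwarz inequality of the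
  semidefinite form \<open>Tx \<bullet> y\<close> applied to \<open>p\<close> and \<open>Tp\<close>.
\<close>

section \<open>Riesz representation and orthogonal projection on complete subspaces\<close>

lemma linear_coeff_zero_if_quadratic_nonneg:
  fixes a b :: real
  assumes "\<And>t. 0 \<le> a * t\<^sup>2 + 2 * b * t"
  shows "b = 0"
proof (rule ccontr)
  assume "b \<noteq> 0"
  \<comment> \<open>This scale gives \<open>a * s < 1\<close> whatever the sign of \<open>a\<close>;
    at \<open>t = - b * s\<close> the linear term then outweighs the quadratic one.\<close>
  define s where "s = 1 / (\<bar>a\<bar> + 1)"
  have s: "s > 0" "a * s < 1"
    by (auto simp: s_def field_simps abs_if)
  have "a * (- b * s)\<^sup>2 + 2 * b * (- b * s) = b\<^sup>2 * s * (a * s - 2)"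
    by (simp add: power2_eq_square algebra_simps)
  moreover have "b\<^sup>2 * s * (a * s - 2) < 0"
    using s \<open>b \<noteq> 0\<close> by (intro mult_pos_neg) auto
  ultimately show False
    using assms[of "- b * s"] by linarith
qed

text \<open>The representer minimises \<open>J x = x \<bullet> x - 2 * f x\<close> over
  \<open>V\<close>, and the claim is the first-order condition there. Minimising sequences are
  Cauchy by the parallelogram law; completeness of \<open>V\<close> supplies the limit.\<close>

theorem riesz_representation_complete_subspace:
  fixes f :: "'a::real_inner \<Rightarrow> real"
  assumes f: "bounded_linear f" and V: "subspace V" "complete V"
  obtains u where "u \<in> V" "\<And>v. v \<in> V \<Longrightarrow> u \<bullet> v = f v"
proof -
  interpret f: bounded_linear f by (rule f)
  define J where "J x = x \<bullet> x - 2 * f x" for x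
  obtain B where B: "\<And>x. norm (f x) \<le> norm x * B"
    using f.bounded by blast
  have J_lower: "- B\<^sup>2 \<le> J x" for x
  proof -
    have "0 \<le> (norm x - B)\<^sup>2" by simp
    then show ?thesis
      using B[of x] by (simp add: J_def power2_norm_eq_inner[symmetric] power2_diff)
  qed
  have bdd: "bdd_below (J ` V)"
    using J_lower by (auto simp: bdd_below_def)
  define d where "d = Inf (J ` V)"
  have d_le: "d \<le> J x" if "x \<in> V" for x
    unfolding d_def using bdd that by (simp add: cInf_lower)
  have "\<exists>x\<in>V. J x < d + inverse (real (Suc n))" for n
    using cInf_lessD[of "J ` V" "d + inverse (real (Suc n))"] subspace_0[OF V(1)]
    by (auto simp: d_def)
  then obtain X where X: "\<And>n. X n \<in> V" "\<And>n. J (X n) < d + inverse (real (Suc n))"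
    by metis
  \<comment> \<open>The linear parts of \<open>J\<close> cancel in the parallelogram law. The
    midpoint of two points of \<open>V\<close> stays in \<open>V\<close>, so its value is at least
    \<open>d\<close>.\<close>
  have parallelogram: "(dist x y)\<^sup>2 = 2 * J x + 2 * J y - 4 * J ((1 / 2) *\<^sub>R (x + y))" for x y
    by (simp add: J_def dist_norm power2_norm_eq_inner f.scaleR f.add inner_diff inner_add
        inner_commute algebra_simps)
  have dist_X: "(dist (X m) (X n))\<^sup>2 < 4 * inverse (real (Suc N))" if "N \<le> m" "N \<le> n" for m n N
  proof -
    have "d \<le> J ((1 / 2) *\<^sub>R (X m + X n))"
      by (intro d_le subspace_scale[OF V(1)] subspace_add[OF V(1)] X)
    moreover have "inverse (real (Suc m)) \<le> inverse (real (Suc N))"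
      "inverse (real (Suc n)) \<le> inverse (real (Suc N))"
      using that by (auto intro!: le_imp_inverse_le)
    ultimately show ?thesis
      using parallelogram[of "X m" "X n"] X(2)[of m] X(2)[of n] by linarith
  qed
  have "Cauchy X"
  proof (rule metric_CauchyI)
    fix e :: real assume "0 < e"
    then obtain N where N: "inverse (real (Suc N)) < e\<^sup>2 / 4"
      using reals_Archimedean[of "e\<^sup>2 / 4"] by auto
    have "dist (X m) (X n) < e" if "N \<le> m" "N \<le> n" for m n
    proof (rule power2_less_imp_less)
      show "(dist (X m) (X n))\<^sup>2 < e\<^sup>2"
        using dist_X[OF that] N by linarith
    qed (use \<open>0 < e\<close> in simp)
    then show "\<exists>M. \<forall>m\<ge>M. \<forall>n\<ge>M. dist (X m) (X n) < e" by blast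
  qed
  then obtain u where u: "u \<in> V" "X \<longlonglongrightarrow> u"
    using V(2) X(1) unfolding complete_def by blast
  have "(\<lambda>n. J (X n)) \<longlonglongrightarrow> J u"
    unfolding J_def by (intro tendsto_intros f.tendsto u(2))
  moreover have "(\<lambda>n. d + inverse (real (Suc n))) \<longlonglongrightarrow> d + 0"
    by (intro tendsto_intros LIMSEQ_inverse_real_of_nat)
  ultimately have "J u \<le> d + 0"
    using X(2) by (intro LIMSEQ_le) (auto intro!: exI[of _ 0] less_imp_le)
  have "u \<bullet> v = f v" if "v \<in> V" for v
  proof -
    \<comment> \<open>The right-hand side is \<open>J (u + t *\<^sub>R v) - J u\<close>.\<close>
    have "0 \<le> (v \<bullet> v) * t\<^sup>2 + 2 * (u \<bullet> v - f v) * t" for t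
    proof -
      have "J u \<le> J (u + t *\<^sub>R v)"
        using \<open>J u \<le> d + 0\<close> d_le[of "u + t *\<^sub>R v"] that u(1)
        by (simp add: subspace_add[OF V(1)] subspace_scale[OF V(1)])
      then show ?thesis
        by (simp add: J_def f.add f.scaleR inner_add inner_commute power2_eq_square algebra_simps)
    qed
    from linear_coeff_zero_if_quadratic_nonneg[OF this] show ?thesis by simp
  qed
  with u(1) show thesis by (rule that)
qed

text \<open>The projection is the Riesz representer in \<open>V\<close> of the inner product with
  \<open>x\<close>.\<close>

lemma orthogonal_projection_exists:
  fixes x :: "'a::real_inner"
  assumes "subspace V" "complete V"
  obtains p where "p \<in> V" "\<And>v. v \<in> V \<Longrightarrow> (x - p) \<bullet> v = 0"
proof -
  obtain p where "p \<in> V" "\<And>v. v \<in> V \<Longrightarrow> p \<bullet> v = x \<bullet> v"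
    using riesz_representation_complete_subspace[OF bounded_linear_inner_right assms] by blast
  then show thesis using that by (simp add: inner_diff)
qed

section \<open>Adjoints and uniqueness of the Moore-Penrose inverse\<close>

text \<open>\<open>adjoint\<close> is a Hilbert choice, so some function with this property must
  first be exhibited; Riesz on the whole space supplies its values.\<close>

lemma inner_adjoint:
  fixes f :: "'a::{real_inner, complete_space} \<Rightarrow> 'b::real_inner"
  assumes "bounded_linear f"
  shows "f x \<bullet> y = x \<bullet> adjoint f y"
proof -
  have "\<exists>u. \<forall>x. f x \<bullet> y = x \<bullet> u" for y
  proof -
    have "bounded_linear (\<lambda>x. f x \<bullet> y)"
      using bounded_linear_compose[OF bounded_linear_inner_left assms] .
    from riesz_representation_complete_subspace[OF this subspace_UNIV complete_UNIV]
    obtain u where "\<And>v. u \<bullet> v = f v \<bullet> y" by auto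
    then show ?thesis by (metis inner_commute)
  qed
  then have "\<exists>g. \<forall>x y. f x \<bullet> y = x \<bullet> g y" by metis
  then show ?thesis
    unfolding adjoint_def by (rule someI2_ex) blast
qed

text \<open>Both sides equal \<open>P x \<bullet> P y\<close>. This serves to check the two adjoint
  conditions on a Moore-Penrose inverse.\<close>

lemma symmetric_if_orthogonal_residual:
  fixes P :: "'a::real_inner \<Rightarrow> 'a"
  assumes "\<And>x. P x \<in> V" "\<And>x v. v \<in> V \<Longrightarrow> (x - P x) \<bullet> v = 0"
  shows "P x \<bullet> y = x \<bullet> P y"
proof -
  have "P x \<bullet> y = P x \<bullet> P y"
    using assms(2)[of "P x" y] assms(1) by (simp add: inner_diff inner_commute)
  also have "\<dots> = x \<bullet> P y"
    using assms(2)[of "P y" x] assms(1) by (simp add: inner_diff)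
  finally show ?thesis .
qed

text \<open>Passing to adjoints turns \<open>Q \<circ> P = P\<close> into
  \<open>P \<circ> Q = P\<close>, to be compared with \<open>P \<circ> Q = Q\<close>.\<close>

lemma symmetric_projections_eq:
  fixes P Q :: "'a::real_inner \<Rightarrow> 'a"
  assumes "\<And>x y. P x \<bullet> y = x \<bullet> P y" "\<And>x y. Q x \<bullet> y = x \<bullet> Q y"
    and "P \<circ> Q = Q" "Q \<circ> P = P"
  shows "P = Q"
proof
  fix x
  have "P x \<bullet> y = Q x \<bullet> y" for y
  proof -
    have "P x \<bullet> y = x \<bullet> Q (P y)"
      using assms(1) fun_cong[OF assms(4), of y] by simp
    also have "\<dots> = P (Q x) \<bullet> y"
      by (simp add: assms(1,2))
    also have "\<dots> = Q x \<bullet> y"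
      using fun_cong[OF assms(3), of x] by simp
    finally show ?thesis .
  qed
  then show "P x = Q x"
    by (metis inner_eq_zero_iff inner_diff_left right_minus_eq)
qed

text \<open>\<open>T \<circ> S\<close> and \<open>T \<circ> S'\<close> are symmetric and fix each
  other's values, hence coincide, so \<open>S x - S' x\<close> lies in the kernel of
  \<open>T\<close>. Symmetry of \<open>S \<circ> T\<close> and \<open>S' \<circ> T\<close> makes the
  values of \<open>S\<close> and \<open>S'\<close> orthogonal to that kernel, so the difference is
  orthogonal to itself.\<close>

lemma is_mp_inverse_unique:
  fixes T :: "'a::{real_inner, complete_space} \<Rightarrow> 'a"
  assumes T: "bounded_linear T" and S: "is_mp_inverse T S" and S': "is_mp_inverse T S'"
  shows "S = S'"
proof -
  have sym: "T (R x) \<bullet> y = x \<bullet> T (R y)" "R (T x) \<bullet> y = x \<bullet> R (T y)"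
    if "is_mp_inverse T R" for R x y
  proof -
    have "bounded_linear R" "adjoint (T \<circ> R) = T \<circ> R" "adjoint (R \<circ> T) = R \<circ> T"
      using that by (auto simp: is_mp_inverse_def)
    then show "T (R x) \<bullet> y = x \<bullet> T (R y)" "R (T x) \<bullet> y = x \<bullet> R (T y)"
      using inner_adjoint[OF bounded_linear_compose[OF T, of R], of x y]
        inner_adjoint[OF bounded_linear_compose[OF _ T, of R], of x y]
      by (auto simp: comp_def)
  qed
  have TRT: "T \<circ> R \<circ> T = T" if "is_mp_inverse T R" for R
    using that by (simp add: is_mp_inverse_def)
  have TS: "T \<circ> S = T \<circ> S'"
  proof (rule symmetric_projections_eq)
    show "T \<circ> S \<circ> (T \<circ> S') = T \<circ> S'" "T \<circ> S' \<circ> (T \<circ> S) = T \<circ> S"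
      using TRT[OF S] TRT[OF S'] by (metis comp_assoc)+
  qed (auto simp: sym[OF S] sym[OF S'])
  have "S x = S' x" for x
  proof -
    define w where "w = S x - S' x"
    have "T w = 0"
      using fun_cong[OF TS, of x] linear_diff[OF bounded_linear.linear[OF T], of "S x" "S' x"] by (simp add: w_def)
    have "R (T (R y)) \<bullet> w = 0" if R: "is_mp_inverse T R" for R y
    proof -
      have "R 0 = 0"
        using R by (simp add: is_mp_inverse_def bounded_linear.linear linear_0)
      then show ?thesis
        using sym(2)[OF R, of "R y" w] \<open>T w = 0\<close> by simp
    qed
    moreover have "S (T (S x)) = S x" "S' (T (S' x)) = S' x"
      using S S' by (auto simp: is_mp_inverse_def fun_eq_iff)
    ultimately have "S x \<bullet> w = 0" "S' x \<bullet> w = 0"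
      using S S' by metis+
    then have "w \<bullet> w = 0"
      by (simp add: w_def inner_diff_left)
    then show ?thesis by (simp add: w_def)
  qed
  then show ?thesis ..
qed

lemma mp_inverse_eqI:
  fixes T :: "'a::{real_inner, complete_space} \<Rightarrow> 'a"
  assumes "bounded_linear T" "is_mp_inverse T S"
  shows "mp_inverse T = S"
  unfolding mp_inverse_def using assms is_mp_inverse_unique by blast

section \<open>Closed range and existence of the Moore-Penrose inverse\<close>

lemma subspace_closure:
  fixes S :: "'a::real_normed_vector set"
  assumes "subspace S"
  shows "subspace (closure S)"
proof (rule subspaceI)
  show "0 \<in> closure S"
    using subspace_0[OF assms] closure_subset by blast
next
  fix x y assume "x \<in> closure S" "y \<in> closure S"
  then obtain X Y where "\<And>n. X n \<in> S" "X \<longlonglongrightarrow> x" "\<And>n. Y n \<in> S" "Y \<longlonglongrightarrow> y"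
    unfolding closure_sequential by blast
  then show "x + y \<in> closure S"
    unfolding closure_sequential
    by (intro exI[of _ "\<lambda>n. X n + Y n"]) (auto intro: tendsto_add subspace_add[OF assms])
next
  fix c x assume "x \<in> closure S"
  then obtain X where "\<And>n. X n \<in> S" "X \<longlonglongrightarrow> x"
    unfolding closure_sequential by blast
  then show "c *\<^sub>R x \<in> closure S"
    unfolding closure_sequential
    by (intro exI[of _ "\<lambda>n. c *\<^sub>R X n"]) (auto intro: tendsto_intros subspace_scale[OF assms])
qed

text \<open>Coercivity passes by continuity to the closure \<open>V\<close> of the range, so
  \<open>T\<close> is bounded below on the complete space \<open>V\<close> and maps it onto a
  complete set. That image is the whole range, since \<open>T\<close> kills the component of a
  vector orthogonal to \<open>V\<close>.\<close>

lemma coercive_symmetric_closed_range: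
  fixes T :: "'a::{real_inner, complete_space} \<Rightarrow> 'a"
  assumes T: "bounded_linear T" and sym: "\<And>x y. T x \<bullet> y = x \<bullet> T y"
    and c: "0 < c" "\<And>v. v \<in> range T \<Longrightarrow> c * (norm v)\<^sup>2 \<le> T v \<bullet> v"
  shows "closed (range T)"
proof -
  interpret T: bounded_linear T by (rule T)
  define V where "V = closure (range T)"
  have V: "subspace V" "complete V"
    unfolding V_def using linear_subspace_image[OF T.linear subspace_UNIV]
    by (auto simp: complete_eq_closed subspace_closure)
  have coercive: "0 \<le> T v \<bullet> v - c * (norm v)\<^sup>2" if "v \<in> V" for v
    by (rule continuous_ge_on_closure[of "range T" "\<lambda>v. T v \<bullet> v - c * (norm v)\<^sup>2"])
      (use that c in \<open>auto simp: V_def intro!: continuous_intros T.continuous_on\<close>)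
  have "c * norm v \<le> norm (T v)" if "v \<in> V" for v
  proof (cases "v = 0")
    case False
    have "(c * norm v) * norm v \<le> norm (T v) * norm v"
      using coercive[OF that] norm_cauchy_schwarz[of "T v" v]
      by (simp add: power2_eq_square)
    then show ?thesis using False by simp
  qed (simp add: T.zero)
  then have "complete (T ` V)"
    by (intro complete_isometric_image[OF c(1) V(1) T _ V(2)]) auto
  moreover have "range T = T ` V"
  proof -
    have "T x \<in> T ` V" for x
    proof -
      obtain p where p: "p \<in> V" "\<And>v. v \<in> V \<Longrightarrow> (x - p) \<bullet> v = 0"
        using orthogonal_projection_exists[OF V] by blast
      \<comment> \<open>Symmetry turns the squared norm of \<open>T (x - p)\<close> into the inner
        product of \<open>x - p\<close> with this vector of \<open>V\<close>.\<close>
      have "T (T (x - p)) \<in> V"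
        unfolding V_def by (rule subsetD[OF closure_subset rangeI])
      then have "T (x - p) \<bullet> T (x - p) = 0"
        using p(2) by (simp add: sym)
      then show ?thesis
        using p(1) by (simp add: T.diff)
    qed
    then show ?thesis by blast
  qed
  ultimately show ?thesis
    by (simp add: complete_imp_closed)
qed

text \<open>The inverse is built by hand: project \<open>y\<close> orthogonally onto
  \<open>range T\<close>, then invert \<open>T\<close> on its range. Uniqueness identifies the
  result with \<open>mp_inverse T\<close>.\<close>

lemma coercive_symmetric_mp_inverse:
  fixes T :: "'a::{real_inner, complete_space} \<Rightarrow> 'a"
  assumes T: "bounded_linear T" and sym: "\<And>x y. T x \<bullet> y = x \<bullet> T y"
    and c: "0 < c" "\<And>v. v \<in> range T \<Longrightarrow> c * (norm v)\<^sup>2 \<le> T v \<bullet> v"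
  shows "mp_inverse T y \<in> range T" and "y \<in> range T \<Longrightarrow> T (mp_inverse T y) = y"
proof -
  interpret T: bounded_linear T by (rule T)
  define V where "V = range T"
  have V: "subspace V" "complete V"
    unfolding V_def
    using linear_subspace_image[OF T.linear subspace_UNIV] coercive_symmetric_closed_range[OF assms]
    by (auto simp: complete_eq_closed)
  have TV: "T x \<in> V" for x by (simp add: V_def)
  \<comment> \<open>Projecting \<open>y\<close> gives some \<open>T x\<close>; replacing
    \<open>x\<close> by its own projection \<open>v\<close> changes it by a kernel vector, so the
    preimage can be taken in \<open>V\<close>.\<close>
  have ex: "\<exists>v\<in>V. \<forall>w\<in>V. (y - T v) \<bullet> w = 0" for y
  proof -
    obtain p where p: "p \<in> V" "\<And>v. v \<in> V \<Longrightarrow> (y - p) \<bullet> v = 0"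
      using orthogonal_projection_exists[OF V] by blast
    obtain x where x: "p = T x" using p(1) by (auto simp: V_def)
    obtain v where v: "v \<in> V" "\<And>w. w \<in> V \<Longrightarrow> (x - v) \<bullet> w = 0"
      using orthogonal_projection_exists[OF V] by blast
    have "T (x - v) \<bullet> T (x - v) = 0"
      using v(2)[OF TV[of "T (x - v)"]] by (simp add: sym)
    then have "p = T v" by (simp add: x T.diff)
    with p v(1) show ?thesis by blast
  qed
  define S where "S y = (SOME v. v \<in> V \<and> (\<forall>w\<in>V. (y - T v) \<bullet> w = 0))" for y
  have "S y \<in> V \<and> (\<forall>w\<in>V. (y - T (S y)) \<bullet> w = 0)" for y
    unfolding S_def by (rule someI_ex) (use ex in blast)
  then have S: "S y \<in> V" "w \<in> V \<Longrightarrow> (y - T (S y)) \<bullet> w = 0" for y w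
    by blast+
  \<comment> \<open>Two candidates differ by a vector of \<open>V\<close> on which the form
    vanishes, so coercivity makes them equal. Linearity of \<open>S\<close> and
    \<open>S (T (S y)) = S y\<close> then reduce to checking candidates.\<close>
  have S_eqI: "S y = v" if v: "v \<in> V" "\<And>w. w \<in> V \<Longrightarrow> (y - T v) \<bullet> w = 0" for y v
  proof -
    have "S y - v \<in> V"
      by (intro subspace_diff[OF V(1)] S v(1))
    moreover have "T (S y - v) \<bullet> (S y - v) = 0"
      using S(2)[of "S y - v" y] v(2)[of "S y - v"] calculation
      by (simp add: T.diff inner_diff_left)
    ultimately have "c * (norm (S y - v))\<^sup>2 \<le> 0"
      using c(2)[of "S y - v"] by (simp add: V_def)
    then show ?thesis
      using c(1) by (simp add: mult_le_0_iff)
  qed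
  have "bounded_linear S"
  proof (rule bounded_linear_intro[of _ "1 / c"])
    show "S (x + y) = S x + S y" for x y
      using S(2)[of _ x] S(2)[of _ y]
      by (intro S_eqI subspace_add[OF V(1)] S(1))
        (simp add: T.add inner_diff_left inner_add_left)
    show "S (r *\<^sub>R x) = r *\<^sub>R S x" for r x
      using S(2)[of _ x]
      by (intro S_eqI subspace_scale[OF V(1)] S(1)) (simp add: T.scaleR inner_diff_left)
    show "norm (S x) \<le> norm x * (1 / c)" for x
    proof (cases "S x = 0")
      case False
      have "c * (norm (S x))\<^sup>2 \<le> T (S x) \<bullet> S x"
        using c(2) S(1) by (simp add: V_def)
      also have "\<dots> = x \<bullet> S x"
        using S(2)[OF S(1), of x x] by (simp add: inner_diff_left)
      also have "\<dots> \<le> norm x * norm (S x)"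
        by (rule norm_cauchy_schwarz)
      finally have "(c * norm (S x)) * norm (S x) \<le> norm x * norm (S x)"
        by (simp add: power2_eq_square)
      then show ?thesis
        using False c(1) by (simp add: field_simps)
    qed (use c(1) in simp)
  qed
  moreover have TS: "T (S y) = y" if "y \<in> V" for y
  proof -
    have "y - T (S y) \<in> V"
      by (intro subspace_diff[OF V(1)] that TV)
    then show ?thesis
      using S(2)[of "y - T (S y)" y] by simp
  qed
  moreover have "S (T (S y)) = S y" for y
    by (rule S_eqI) (auto simp: S)
  moreover have "adjoint (T \<circ> S) = T \<circ> S"
  proof (rule adjoint_unique, intro allI)
    show "(T \<circ> S) x \<bullet> y = x \<bullet> (T \<circ> S) y" for x y
      by (rule symmetric_if_orthogonal_residual[of _ V]) (simp_all add: TV S)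
  qed
  moreover have "adjoint (S \<circ> T) = S \<circ> T"
  proof (rule adjoint_unique, intro allI)
    \<comment> \<open>Since \<open>T (S (T x)) = T x\<close>, moving \<open>T\<close> to the left
      factor gives zero. Thus \<open>S \<circ> T\<close>, like \<open>T \<circ> S\<close>, projects
      orthogonally onto \<open>V\<close>.\<close>
    have "(x - S (T x)) \<bullet> T z = 0" for x z
      using TS[OF TV, of x] by (simp add: sym[symmetric] T.diff)
    then show "(S \<circ> T) x \<bullet> y = x \<bullet> (S \<circ> T) y" for x y
      by (intro symmetric_if_orthogonal_residual[of _ V]) (use S(1) in \<open>auto simp: V_def\<close>)
  qed
  ultimately have "is_mp_inverse T S"
    by (auto simp: is_mp_inverse_def fun_eq_iff TV)
  then have "mp_inverse T = S"
    by (rule mp_inverse_eqI[OF T])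
  then show "mp_inverse T y \<in> range T" "y \<in> range T \<Longrightarrow> T (mp_inverse T y) = y"
    using S TS by (auto simp: V_def)
qed

section \<open>Bounds of the quadratic form and the distance estimate\<close>

text \<open>Discriminant argument along the line \<open>x + t *\<^sub>R y\<close>. The form may be
  degenerate: if \<open>T y \<bullet> y = 0\<close>, the polynomial is affine in \<open>t\<close>
  and its slope must vanish.\<close>

lemma symmetric_cauchy_schwarz:
  fixes T :: "'a::real_inner \<Rightarrow> 'a"
  assumes T: "linear T" and sym: "\<And>x y. T x \<bullet> y = x \<bullet> T y"
    and nonneg: "\<And>x. 0 \<le> T x \<bullet> x"
  shows "(T x \<bullet> y)\<^sup>2 \<le> (T x \<bullet> x) * (T y \<bullet> y)"
proof -
  have *: "0 \<le> (T y \<bullet> y) * t\<^sup>2 + 2 * (T x \<bullet> y) * t + T x \<bullet> x" for t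
    using nonneg[of "x + t *\<^sub>R y"] sym[of y x]
    by (simp add: linear_add[OF T] linear_scale[OF T] inner_add inner_commute
        power2_eq_square algebra_simps)
  show ?thesis
  proof (cases "T y \<bullet> y = 0")
    case True
    have "T x \<bullet> y = 0"
    proof (rule ccontr)
      assume "T x \<bullet> y \<noteq> 0"
      \<comment> \<open>At this \<open>t\<close> the affine function takes the value
        \<open>-1\<close>.\<close>
      then show False
        using *[of "- (T x \<bullet> x + 1) / (2 * (T x \<bullet> y))"] True by simp
    qed
    then show ?thesis using True by simp
  next
    case False
    then show ?thesis
      \<comment> \<open>This \<open>t\<close> minimises the quadratic.\<close>
      using *[of "- (T x \<bullet> y) / (T y \<bullet> y)"] nonneg[of y]
      by (simp add: field_simps power2_eq_square)
  qed
qed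

text \<open>Normalise \<open>v\<close> and use homogeneity of degree two. A real bound
  \<open>c\<close> stands in for the infimum, which may be infinite.\<close>

lemma reduced_num_inf_coercive:
  assumes T: "linear T" and "ereal c \<le> reduced_num_inf T" and v: "v \<in> range (adjoint T)"
    and adj: "linear (adjoint T)"
  shows "c * (norm v)\<^sup>2 \<le> T v \<bullet> v"
proof (cases "v = 0")
  case False
  define e where "e = (1 / norm v) *\<^sub>R v"
  have "norm e = 1" "e \<in> range (adjoint T)"
    using False v subspace_scale[OF linear_subspace_image[OF adj subspace_UNIV]]
    by (auto simp: e_def)
  then have "reduced_num_inf T \<le> ereal (T e \<bullet> e)"
    unfolding reduced_num_inf_def by (intro INF_lower) auto
  with assms(2) have "c \<le> T e \<bullet> e"
    using order_trans ereal_less_eq(3) by blast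
  then show ?thesis
    using False by (simp add: e_def linear_scale[OF T] field_simps power2_eq_square)
qed (simp add: linear_0[OF T])

lemma num_sup_bound:
  assumes T: "linear T" and "num_sup T \<le> ereal M"
  shows "T v \<bullet> v \<le> M * (norm v)\<^sup>2"
proof (cases "v = 0")
  case False
  define e where "e = (1 / norm v) *\<^sub>R v"
  have "norm e = 1"
    using False by (simp add: e_def)
  then have "ereal (T e \<bullet> e) \<le> num_sup T"
    unfolding num_sup_def by (intro SUP_upper) auto
  with assms(2) have "T e \<bullet> e \<le> M"
    using order_trans ereal_less_eq(3) by blast
  then show ?thesis
    using False by (simp add: e_def linear_scale[OF T] field_simps power2_eq_square)
qed (simp add: linear_0[OF T])

text \<open>Serves to exclude the value \<infinity>, so that the final estimate can use a real
  \<open>M\<close>.\<close>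

lemma num_sup_le_onorm:
  assumes "bounded_linear T"
  shows "num_sup T \<le> ereal (onorm T)"
  unfolding num_sup_def
proof (rule SUP_least)
  fix x :: 'a assume "x \<in> {x. norm x = 1}"
  then show "ereal (T x \<bullet> x) \<le> ereal (onorm T)"
    using norm_cauchy_schwarz[of "T x" x] onorm[OF assms, of x] by simp
qed

text \<open>Here \<open>p\<close> stands for \<open>T\<^sup>\<dagger> b\<close> and \<open>d\<close> for \<open>x - x\<^sub>b\<close>.\<close>

lemma lcp_distance_bounds:
  fixes T :: "'a::real_inner \<Rightarrow> 'a"
  assumes T: "linear T" and sym: "\<And>x y. T x \<bullet> y = x \<bullet> T y"
    and nonneg: "\<And>x. 0 \<le> T x \<bullet> x"
    and m: "0 < m" "\<And>v. v \<in> range T \<Longrightarrow> m * (norm v)\<^sup>2 \<le> T v \<bullet> v"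
    and M: "0 < M" "\<And>v. T v \<bullet> v \<le> M * (norm v)\<^sup>2"
    and p: "p \<in> range T" and x: "x \<in> range T" "x \<bullet> (T x + T p) = 0"
    and d: "d = x + (1 / 2) *\<^sub>R p"
  shows "norm (T p) / (2 * M) \<le> norm d" "norm d \<le> norm (T p) / (2 * m)"
proof -
  let ?b = "T p"
  have "d \<in> range T"
    unfolding d using linear_subspace_image[OF T subspace_UNIV] x(1) p
    by (intro subspace_add subspace_scale)
  \<comment> \<open>By symmetry the cross terms sum to \<open>T p \<bullet> x\<close>, which
    complementarity cancels against \<open>T x \<bullet> x\<close>.\<close>
  have Td: "T d \<bullet> d = (?b \<bullet> p) / 4"
    using x(2) sym[of p x] sym[of x p]
    by (simp add: d linear_add[OF T] linear_scale[OF T] inner_add inner_commute algebra_simps)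
  have mp: "m * norm p \<le> norm ?b"
  proof (cases "p = 0")
    case False
    have "(m * norm p) * norm p \<le> norm ?b * norm p"
      using m(2)[OF p] norm_cauchy_schwarz[of ?b p] by (simp add: power2_eq_square)
    then show ?thesis using False by simp
  qed simp
  \<comment> \<open>Coercivity enters twice: at \<open>d\<close>, combined with \<open>Td\<close>,
    and at \<open>p\<close> through \<open>mp\<close>.\<close>
  have "(2 * m * norm d)\<^sup>2 = 4 * m * (m * (norm d)\<^sup>2)"
    by (simp add: power2_eq_square)
  also have "\<dots> \<le> 4 * m * ((?b \<bullet> p) / 4)"
    using m(2)[OF \<open>d \<in> range T\<close>] m(1) Td by (intro mult_left_mono) auto
  also have "\<dots> \<le> norm ?b * (m * norm p)"
    using norm_cauchy_schwarz[of ?b p] m(1) by (simp add: mult.left_commute)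
  also have "\<dots> \<le> (norm ?b)\<^sup>2"
    using mp by (simp add: power2_eq_square mult_left_mono)
  finally have "2 * m * norm d \<le> norm ?b"
    by (rule power2_le_imp_le) simp
  then show "norm d \<le> norm ?b / (2 * m)"
    using m(1) by (simp add: field_simps)
  have bM: "(norm ?b)\<^sup>2 \<le> M * (?b \<bullet> p)"
  proof (cases "?b = 0")
    case False
    \<comment> \<open>The form at \<open>p\<close> and \<open>?b\<close> is
      \<open>T p \<bullet> ?b\<close>, the squared norm of \<open>?b\<close>; one factor
      \<open>(norm ?b)\<^sup>2\<close> is cancelled at the end.\<close>
    have "(norm ?b)\<^sup>2 * (norm ?b)\<^sup>2 = (?b \<bullet> ?b)\<^sup>2"
      by (simp add: power2_norm_eq_inner power2_eq_square[of "?b \<bullet> ?b"])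
    also have "\<dots> \<le> (?b \<bullet> p) * (T ?b \<bullet> ?b)"
      by (rule symmetric_cauchy_schwarz[OF T sym nonneg])
    also have "\<dots> \<le> (?b \<bullet> p) * (M * (norm ?b)\<^sup>2)"
      by (intro mult_left_mono M nonneg)
    finally have "(norm ?b)\<^sup>2 * (norm ?b)\<^sup>2 \<le> (M * (?b \<bullet> p)) * (norm ?b)\<^sup>2"
      by (simp add: mult_ac)
    then show ?thesis
      using False by (simp only: mult_le_cancel_right) auto
  qed simp
  also have "\<dots> \<le> M * (4 * (M * (norm d)\<^sup>2))"
    using M(1) M(2)[of d] Td by (intro mult_left_mono) auto
  also have "\<dots> = (2 * M * norm d)\<^sup>2"
    by (simp add: power2_eq_square)
  finally have "norm ?b \<le> 2 * M * norm d"
    by (rule power2_le_imp_le) (use M(1) in simp)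
  then show "norm ?b / (2 * M) \<le> norm d"
    using M(1) by (simp add: field_simps)
qed

theorem theorem4p5:
  fixes T :: "'a::{real_inner, complete_space} \<Rightarrow> 'a"
    and K :: "'a set" and b x_b :: 'a
  assumes "pointed_convex_cone K"
    and "bounded_linear T"
    and "adjoint T = T"
    and "reduced_num_inf T > 0"
    and "b \<in> range T"
    and "x_b = - (1 / 2) *\<^sub>R mp_inverse T b"
  shows "\<forall>x \<in> range T. lcp_solution K T b x \<and> x \<noteq> x_b \<longrightarrow>
    ereal (norm b) / (2 * num_sup T) \<le> ereal (norm (x - x_b)) \<and>
    ereal (norm (x - x_b)) \<le> ereal (norm b) / (2 * reduced_num_inf T)"
proof (intro ballI impI)
  fix x assume x: "x \<in> range T" "lcp_solution K T b x \<and> x \<noteq> x_b"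
  interpret T: bounded_linear T by (rule assms(2))
  have lin: "linear T" by (rule T.linear)
  have sym: "T x \<bullet> y = x \<bullet> T y" for x y
    using inner_adjoint[OF assms(2)] assms(3) by simp
  have coercive: "r * (norm v)\<^sup>2 \<le> T v \<bullet> v" if "ereal r \<le> reduced_num_inf T" "v \<in> range T" for r v
    using reduced_num_inf_coercive[OF lin that(1)] that(2) assms(3) lin by simp
  \<comment> \<open>The infimum is not yet known to be finite, so a positive real \<open>c\<close>
    below it provides the coercivity constant for \<open>mp_inverse\<close>.\<close>
  obtain c where c: "0 < c" "ereal c \<le> reduced_num_inf T"
    using ereal_dense2[OF assms(4)] by (auto simp: less_imp_le)
  define p where "p = mp_inverse T b"
  have p: "p \<in> range T" "T p = b"
    using coercive_symmetric_mp_inverse[OF assms(2) sym c(1) coercive[OF c(2)]] assms(5)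
    by (auto simp: p_def)
  have nonneg: "0 \<le> T y \<bullet> y" for y
  proof -
    \<comment> \<open>Coercivity is available on the range, so \<open>y\<close> is replaced by a
      \<open>q\<close> there with \<open>T q = T y\<close>; by symmetry the form takes the same
      value at both.\<close>
    define q where "q = mp_inverse T (T y)"
    have q: "q \<in> range T" "T q = T y"
      using coercive_symmetric_mp_inverse[OF assms(2) sym c(1) coercive[OF c(2)]]
      by (auto simp: q_def)
    have "T y \<bullet> y = T q \<bullet> q"
      by (metis q(2) sym)
    then show ?thesis
      using coercive[OF c(2) q(1)] c(1) by (smt (verit) mult_nonneg_nonneg zero_le_power2)
  qed
  have d: "x - x_b = x + (1 / 2) *\<^sub>R p"
    by (simp add: assms(6) p_def)
  have "x - x_b \<in> range T"
    unfolding d using linear_subspace_image[OF lin subspace_UNIV] x(1) p(1)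
    by (intro subspace_add subspace_scale)
  \<comment> \<open>As \<open>x \<noteq> x_b\<close>, this is a unit vector of the range. Its form
    value lies above the infimum and below the supremum, which makes the former finite and the
    latter positive.\<close>
  moreover define e where "e = (1 / norm (x - x_b)) *\<^sub>R (x - x_b)"
  ultimately have e: "norm e = 1" "e \<in> range T"
    using x(2) subspace_scale[OF linear_subspace_image[OF lin subspace_UNIV]] by auto
  have m_le: "reduced_num_inf T \<le> ereal (T e \<bullet> e)"
    unfolding reduced_num_inf_def using e assms(3) by (intro INF_lower) auto
  have M_ge: "ereal (T e \<bullet> e) \<le> num_sup T"
    unfolding num_sup_def using e by (intro SUP_upper) auto
  obtain m where m: "reduced_num_inf T = ereal m" "0 < m"
    using m_le assms(4) by (cases "reduced_num_inf T") auto
  obtain M where M: "num_sup T = ereal M" "0 < M"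
    using M_ge m_le m num_sup_le_onorm[OF assms(2)] by (cases "num_sup T") auto
  have "x \<bullet> (T x + T p) = 0"
    using x(2) p(2) by (simp add: lcp_solution_def)
  from lcp_distance_bounds[OF lin sym nonneg m(2) coercive M(2) num_sup_bound[OF lin] p(1) x(1) this d]
  have "norm b / (2 * M) \<le> norm (x - x_b)" "norm (x - x_b) \<le> norm b / (2 * m)"
    using m M p(2) by auto
  moreover have "2 * ereal r = ereal (2 * r)" for r
    by (metis numeral_eq_ereal times_ereal.simps(1))
  ultimately show "ereal (norm b) / (2 * num_sup T) \<le> ereal (norm (x - x_b)) \<and>
      ereal (norm (x - x_b)) \<le> ereal (norm b) / (2 * reduced_num_inf T)"
    using m M by simp
qed

end
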